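(* Let $X$ be a real Banach space with the $\lambda\mathrm{Id}+S$-property and let $T\in L(X)$ be an isometry. Then $T$ is of the form $\mathrm{Id}+K$ or $-\mathrm{Id}+K$, where $K$ is a compact operator on $X$.
   Context: $L(X)$ is the space of bounded linear operators on $X$. A Banach space $X$ over $\mathbb{K}$ has the $\lambda\mathrm{Id}+S$-property if every $T\in L(X)$ is of the form $\lambda\mathrm{Id}+S$ with $\lambda\in\mathbb{K}$ and $S$ strictly singular. Isometry means surjective linear isometry of $X$ onto itself. *)

theory Defs
  imports "HOL-Analysis.Analysis"
begin

(* An isomorphism from the closed subspace Y onto its image is read as a linear homeomorphism
   onto the image; linearity is automatic because S is linear. The library constant dim is 0
   on infinite-dimensional subspaces, so infinite dimension is stated as the absence of a
   finite spanning set. *)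
definition strictly_singular :: "('a::real_normed_vector \<Rightarrow>\<^sub>L 'b::real_normed_vector) \<Rightarrow> bool"
  where "strictly_singular S \<longleftrightarrow>
    (\<forall>Y. subspace Y \<and> closed Y \<and> \<not> (\<exists>B. finite B \<and> span B = Y) \<longrightarrow>
      \<not> (\<exists>R. homeomorphism Y (blinfun_apply S ` Y) (blinfun_apply S) R))"

definition compact_operator :: "('a::real_normed_vector \<Rightarrow>\<^sub>L 'b::real_normed_vector) \<Rightarrow> bool"
  where "compact_operator K \<longleftrightarrow> compact (closure (blinfun_apply K ` cball 0 1))"

definition lambda_Id_plus_S_property :: "'a::banach itself \<Rightarrow> bool"
  where "lambda_Id_plus_S_property X \<longleftrightarrow>
    (\<forall>T :: 'a \<Rightarrow>\<^sub>L 'a. \<exists>(c :: real) S. strictly_singular S \<and> T = c *\<^sub>R id_blinfun + S)"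

definition surjective_isometry :: "('a::real_normed_vector \<Rightarrow>\<^sub>L 'a) \<Rightarrow> bool"
  where "surjective_isometry T \<longleftrightarrow>
    surj (blinfun_apply T) \<and> (\<forall>x. norm (blinfun_apply T x) = norm x)"

end

theory Submission
  imports Defs
begin

text \<open>
  Write \<open>T = c Id + S\<close> with \<open>S\<close> strictly singular. If \<open>X\<close> is infinite-dimensional, then
  \<open>\<bar>c\<bar> = 1\<close>, because otherwise \<open>S = T - c Id\<close> would be bounded below on all of \<open>X\<close>; after
  replacing \<open>T\<close> by \<open>- T\<close> one may assume \<open>T = Id + S\<close>. It remains to show that \<open>S\<close> is a norm
  limit of operators of finite rank. This is a version of Gelfand's theorem that a doubly
  power-bounded element with spectrum \<open>{1}\<close> is the identity, with norm estimates in place of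
  spectral theory. If \<open>X\<close> is finite-dimensional, every operator is compact.

  Let \<open>C = (T + T\<inverse>) / 2\<close>, which plays the role of the cosine when \<open>T\<close> is thought of as
  \<open>e\<^sup>i\<^sup>\<theta>\<close>. Since \<open>Id - C\<^sup>2 = (Id - C\<^sub>2) / 2\<close>, with \<open>C\<^sub>2\<close> formed from \<open>T\<^sup>2\<close>, has norm at most 1, the
  usual iteration for square roots converges and yields an operator \<open>R = Id - E\<close>, commuting with \<open>C\<close>, with
  \<open>R\<^sup>2 = C\<^sup>2\<close> and \<open>\<parallel>E\<parallel> \<le> 1\<close> (\<open>operator_sqrt\<close>). It stands for
  \<open>\<bar>cos \<theta>\<bar>\<close>, and \<open>\<bar>cos \<theta>\<bar> - cos \<theta>\<close> vanishes near \<open>\<theta> = 0\<close>, the only place where \<open>S\<close>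
  fails to be bounded below. Concretely, \<open>(R + C) (R - C) = 0\<close>, and \<open>S\<close> is bounded below on the
  kernel of \<open>R + C\<close>; so that kernel is finite-dimensional, and \<open>R - C\<close> has finite rank
  (\<open>cosine_decomposition\<close>).

  Hence \<open>C\<close> equals \<open>Id - E\<close> modulo finite rank, and \<open>Id - C\<^sub>2 = 2 (Id - C) (Id + C)\<close>
  shows that the distance of \<open>Id - C\<close> from the finite rank operators is at most half of the
  corresponding distance for \<open>T\<^sup>2\<close>. The same applies to \<open>T\<^sup>2, T\<^sup>4, \<dots>\<close>, where the distance is
  always at most 2; so it is 0 (\<open>finite_rank_dist_cosine\<close>). Then \<open>(Id - T)\<^sup>2 = - 2 (Id - C) T\<close>
  has distance 0 as well, so \<open>Id - T\<^sup>2\<close> is \<open>2 (Id - T)\<close> up to distance 0, and a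
  second halving argument gives distance 0 for \<open>Id - T\<close>.
\<close>

section \<open>Operators of finite rank\<close>

definition finite_rank :: "('a::real_normed_vector \<Rightarrow>\<^sub>L 'b::real_normed_vector) \<Rightarrow> bool"
  where "finite_rank K \<longleftrightarrow> (\<exists>B. finite B \<and> range (blinfun_apply K) \<subseteq> span B)"

lemma finite_rank_0: "finite_rank 0"
  unfolding finite_rank_def by (rule exI[of _ "{}"]) auto

lemma finite_rank_add:
  assumes "finite_rank K" "finite_rank L"
  shows "finite_rank (K + L)"
proof -
  obtain A B where "finite A" "finite B"
    and AB: "range (blinfun_apply K) \<subseteq> span A" "range (blinfun_apply L) \<subseteq> span B"
    using assms unfolding finite_rank_def by blast
  have "blinfun_apply (K + L) x \<in> span (A \<union> B)" for x
    unfolding blinfun.add_left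
    by (rule span_add; use AB span_mono[of A "A \<union> B"] span_mono[of B "A \<union> B"] in blast)
  then show ?thesis
    unfolding finite_rank_def using \<open>finite A\<close> \<open>finite B\<close> by (intro exI[of _ "A \<union> B"]) auto
qed

lemma finite_rank_scaleR:
  assumes "finite_rank K"
  shows "finite_rank (c *\<^sub>R K)"
proof -
  obtain A where "finite A" "range (blinfun_apply K) \<subseteq> span A"
    using assms unfolding finite_rank_def by blast
  then show ?thesis
    unfolding finite_rank_def by (intro exI[of _ A]) (auto simp: blinfun.scaleR_left intro!: span_scale)
qed

lemma finite_rank_compose_right:
  assumes "finite_rank K"
  shows "finite_rank (K o\<^sub>L A)"
  using assms unfolding finite_rank_def by auto

lemma finite_rank_compose_left:
  assumes "finite_rank K"
  shows "finite_rank (A o\<^sub>L K)"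
proof -
  obtain B where B: "finite B" "range (blinfun_apply K) \<subseteq> span B"
    using assms unfolding finite_rank_def by blast
  have "blinfun_apply A ` span B = span (blinfun_apply A ` B)"
    by (rule linear_span_image[symmetric]) (simp add: blinfun.bounded_linear_right bounded_linear.linear)
  then have "range (blinfun_apply (A o\<^sub>L K)) \<subseteq> span (blinfun_apply A ` B)"
    using B(2) by auto
  then show ?thesis
    unfolding finite_rank_def using B(1) by blast
qed

text \<open>
  A direct induction on the spanning set: the case for \<open>B\<close> makes \<open>span B\<close> closed, so a new
  vector \<open>b\<close> has positive distance from it, and a bound on \<open>y + t b\<close> bounds \<open>t\<close> and \<open>y\<close>.
\<close>
lemma compact_span_Int_cball:
  fixes B :: "'a::real_normed_vector set"
  assumes "finite B"
  shows "compact (span B \<inter> cball 0 r)"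
  using assms
proof (induction B arbitrary: r rule: finite_induct)
  case empty
  have "span {} \<inter> cball (0::'a) r \<subseteq> {0}" by auto
  then show ?case
    by (meson finite.intros finite_subset finite_imp_compact)
next
  case (insert b B)
  show ?case
  proof (cases "b \<in> span B")
    case True
    then show ?thesis using insert.IH by (simp add: span_redundant)
  next
    case False
    have "closed (span B)"
      unfolding closed_sequential_limits
    proof (intro allI impI)
      fix u l assume u: "(\<forall>n. u n \<in> span B) \<and> u \<longlonglongrightarrow> l"
      then obtain M where M: "\<And>n. norm (u n) \<le> M"
        by (meson Bseq_def convergentI convergent_imp_Bseq)
      have "closed (span B \<inter> cball 0 M)"
        using insert.IH by (rule compact_imp_closed)
      moreover have "\<forall>n. u n \<in> span B \<inter> cball 0 M" using u M by simp
      ultimately have "l \<in> span B \<inter> cball 0 M"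
        using u closed_sequentially by metis
      then show "l \<in> span B" by simp
    qed
    then have "open (- span B)" by (rule open_Compl)
    moreover have "b \<in> - span B" using False by simp
    ultimately obtain d where d: "d > 0" "ball b d \<subseteq> - span B" by (rule openE)
    have bound: "\<bar>t\<bar> * d \<le> norm (y + t *\<^sub>R b)" if y: "y \<in> span B" for y t
    proof (cases "t = 0")
      case False
      have "(-1/t) *\<^sub>R y \<in> span B" using y by (rule span_scale)
      then have "d \<le> dist b ((-1/t) *\<^sub>R y)" using d(2) by (meson ComplD linorder_not_le mem_ball subsetD)
      then have "\<bar>t\<bar> * d \<le> \<bar>t\<bar> * norm (b - (-1/t) *\<^sub>R y)" by (simp add: dist_norm mult_left_mono)
      also have "\<dots> = norm (t *\<^sub>R (b - (-1/t) *\<^sub>R y))" by simp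
      also have "t *\<^sub>R (b - (-1/t) *\<^sub>R y) = y + t *\<^sub>R b" using False by (simp add: algebra_simps)
      finally show ?thesis .
    qed simp
    define m where "m = \<bar>r\<bar> / d"
    define C where "C = (\<lambda>(y, t). y + t *\<^sub>R b) ` ((span B \<inter> cball 0 (\<bar>r\<bar> + m * norm b)) \<times> {-m..m})"
    have "compact C"
      unfolding C_def
      by (intro compact_continuous_image compact_Times insert.IH compact_Icc)
         (auto intro!: continuous_intros simp: case_prod_unfold)
    moreover have "span (insert b B) \<inter> cball 0 r = C \<inter> (span (insert b B) \<inter> cball 0 r)"
    proof -
      have "x \<in> C" if x: "x \<in> span (insert b B)" "norm x \<le> r" for x
      proof -
        obtain t where t: "x - t *\<^sub>R b \<in> span B" using x(1) by (auto simp: span_insert)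
        have "\<bar>t\<bar> * d \<le> \<bar>r\<bar>" using bound[OF t, of t] x(2) by simp
        then have tm: "\<bar>t\<bar> \<le> m" using d(1) by (simp add: m_def field_simps)
        have "norm (x - t *\<^sub>R b) \<le> norm x + \<bar>t\<bar> * norm b"
          using norm_triangle_ineq4[of x "t *\<^sub>R b"] by simp
        also have "\<dots> \<le> \<bar>r\<bar> + m * norm b"
          by (intro add_mono mult_right_mono tm) (use x(2) in auto)
        finally show ?thesis
          unfolding C_def using t tm by (intro image_eqI[of _ _ "(x - t *\<^sub>R b, t)"]) auto
      qed
      then show ?thesis by auto
    qed
    moreover have "C \<inter> (span (insert b B) \<inter> cball 0 r) = C \<inter> cball 0 r"
    proof -
      have "C \<subseteq> span (insert b B)"
      proof -
        have "y + t *\<^sub>R b \<in> span (insert b B)" if "y \<in> span B" for y t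
        proof (rule span_add)
          show "y \<in> span (insert b B)" using that span_mono[of B "insert b B"] by blast
        qed (simp add: span_base span_scale)
        then show ?thesis unfolding C_def by auto
      qed
      then show ?thesis by auto
    qed
    ultimately show ?thesis
      by (metis closed_cball compact_Int_closed)
  qed
qed

lemma compact_operator_closure_finite_rank:
  fixes S :: "'a::real_normed_vector \<Rightarrow>\<^sub>L 'b::banach"
  assumes "S \<in> closure {K. finite_rank K}"
  shows "compact_operator S"
proof -
  let ?A = "blinfun_apply S ` cball 0 1"
  have "\<exists>k. finite k \<and> closure ?A \<subseteq> (\<Union>x\<in>k. ball x e)" if "e > 0" for e
  proof -
    obtain K where K: "finite_rank K" "dist K S < e / 3"
      using assms \<open>e > 0\<close> unfolding closure_approachable
      by (metis mem_Collect_eq zero_less_divide_iff zero_less_numeral)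
    obtain B where B: "finite B" "range (blinfun_apply K) \<subseteq> span B"
      using K(1) unfolding finite_rank_def by blast
    have "compact (span B \<inter> cball 0 (norm K))" using B(1) by (rule compact_span_Int_cball)
    then obtain k where k: "finite k" "span B \<inter> cball 0 (norm K) \<subseteq> (\<Union>x\<in>k. ball x (e/3))"
      using \<open>e > 0\<close> unfolding compact_eq_totally_bounded
      by (metis zero_less_divide_iff zero_less_numeral)
    have "?A \<subseteq> (\<Union>x\<in>k. cball x (2*e/3))"
    proof safe
      fix x :: 'a assume "x \<in> cball 0 1"
      then have x: "norm x \<le> 1" by simp
      have "norm (K x) \<le> norm K"
        by (rule order_trans[OF norm_blinfun]) (use x in \<open>simp add: mult_left_le\<close>)
      then have "K x \<in> span B \<inter> cball 0 (norm K)" using B(2) by auto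
      then obtain z where z: "z \<in> k" "dist z (K x) < e/3" using k(2) by auto
      have "dist (K x) (S x) = norm ((K - S) x)" by (simp add: dist_norm blinfun.diff_left)
      also have "\<dots> \<le> norm (K - S)"
        by (rule order_trans[OF norm_blinfun]) (use x in \<open>simp add: mult_left_le\<close>)
      also have "\<dots> < e / 3" using K(2) by (simp add: dist_norm)
      finally have "dist z (S x) \<le> 2*e/3" using z(2) dist_triangle[of z "S x" "K x"] by linarith
      then show "S x \<in> (\<Union>x\<in>k. cball x (2*e/3))" using z(1) by auto
    qed
    moreover have "closed (\<Union>x\<in>k. cball x (2*e/3))" using k(1) by auto
    ultimately have "closure ?A \<subseteq> (\<Union>x\<in>k. cball x (2*e/3))" by (rule closure_minimal)
    also have "\<dots> \<subseteq> (\<Union>x\<in>k. ball x e)" using \<open>e > 0\<close> by force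
    finally show ?thesis using k(1) by blast
  qed
  then show ?thesis
    unfolding compact_operator_def compact_eq_totally_bounded
    by (simp add: complete_eq_closed)
qed


section \<open>The distance to the operators of finite rank\<close>

text \<open>
  This is the quotient seminorm modulo the closure of the finite rank operators. Dividing out
  the compact operators would serve as well, but finite rank operators are visibly an ideal,
  and they are what the strictly singular hypothesis produces.
\<close>
definition finite_rank_dist :: "('a::real_normed_vector \<Rightarrow>\<^sub>L 'b::real_normed_vector) \<Rightarrow> real"
  where "finite_rank_dist A = infdist A {K. finite_rank K}"

lemma finite_rank_dist_le:
  assumes "finite_rank K"
  shows "finite_rank_dist A \<le> norm (A - K)"
  unfolding finite_rank_dist_def dist_norm[symmetric] using assms by (simp add: infdist_le)

lemma finite_rank_dist_le_norm: "finite_rank_dist A \<le> norm A"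
  using finite_rank_dist_le[OF finite_rank_0, of A] by simp

lemma finite_rank_dist_nonneg: "0 \<le> finite_rank_dist A"
  unfolding finite_rank_dist_def by (rule infdist_nonneg)

lemma finite_rank_dist_approx:
  assumes "e > 0"
  obtains K where "finite_rank K" "norm (A - K) < finite_rank_dist A + e"
proof -
  have ne: "{K. finite_rank K} \<noteq> ({} :: ('a \<Rightarrow>\<^sub>L 'b) set)" using finite_rank_0 by blast
  have "Inf (dist A ` {K. finite_rank K}) < finite_rank_dist A + e"
    using assms unfolding finite_rank_dist_def infdist_notempty[OF ne] by simp
  then have "\<exists>r\<in>dist A ` {K. finite_rank K}. r < finite_rank_dist A + e"
    using ne by (intro cInf_lessD) auto
  then show ?thesis using that by (auto simp: dist_norm)
qed

lemma finite_rank_dist_add: "finite_rank_dist (A + B) \<le> finite_rank_dist A + finite_rank_dist B"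
proof (rule field_le_epsilon)
  fix e :: real assume "e > 0"
  then have e: "e / 2 > 0" by simp
  obtain K where K: "finite_rank K" "norm (A - K) < finite_rank_dist A + e/2"
    using finite_rank_dist_approx[OF e] by blast
  obtain L where L: "finite_rank L" "norm (B - L) < finite_rank_dist B + e/2"
    using finite_rank_dist_approx[OF e] by blast
  have "finite_rank_dist (A + B) \<le> norm ((A - K) + (B - L))"
    using finite_rank_dist_le[OF finite_rank_add[OF K(1) L(1)], of "A + B"] by (simp add: algebra_simps)
  also have "\<dots> \<le> norm (A - K) + norm (B - L)" by (rule norm_triangle_ineq)
  finally show "finite_rank_dist (A + B) \<le> finite_rank_dist A + finite_rank_dist B + e"
    using K(2) L(2) by linarith
qed

lemma finite_rank_dist_finite_rank: "finite_rank K \<Longrightarrow> finite_rank_dist K = 0"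
  using finite_rank_dist_le[of K K] finite_rank_dist_nonneg[of K] by simp

lemma finite_rank_dist_scaleR_le: "finite_rank_dist (c *\<^sub>R A) \<le> \<bar>c\<bar> * finite_rank_dist A"
proof (rule field_le_epsilon)
  fix e :: real assume "e > 0"
  then have "e / (\<bar>c\<bar> + 1) > 0" by simp
  then obtain K where K: "finite_rank K" "norm (A - K) < finite_rank_dist A + e / (\<bar>c\<bar> + 1)"
    using finite_rank_dist_approx by blast
  have "finite_rank_dist (c *\<^sub>R A) \<le> norm (c *\<^sub>R A - c *\<^sub>R K)"
    by (rule finite_rank_dist_le[OF finite_rank_scaleR[OF K(1)]])
  also have "\<dots> = \<bar>c\<bar> * norm (A - K)" by (simp flip: scaleR_diff_right)
  also have "\<dots> \<le> \<bar>c\<bar> * (finite_rank_dist A + e / (\<bar>c\<bar> + 1))"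
    using K(2) by (intro mult_left_mono) auto
  also have "\<dots> = \<bar>c\<bar> * finite_rank_dist A + e * (\<bar>c\<bar> / (\<bar>c\<bar> + 1))" by (simp add: algebra_simps)
  also have "e * (\<bar>c\<bar> / (\<bar>c\<bar> + 1)) \<le> e * 1"
    using \<open>e > 0\<close> by (intro mult_left_mono) auto
  finally show "finite_rank_dist (c *\<^sub>R A) \<le> \<bar>c\<bar> * finite_rank_dist A + e" by simp
qed

lemma finite_rank_dist_scaleR: "finite_rank_dist (c *\<^sub>R A) = \<bar>c\<bar> * finite_rank_dist A"
proof (cases "c = 0")
  case True
  then show ?thesis by (simp add: finite_rank_dist_finite_rank finite_rank_0)
next
  case False
  have "\<bar>c\<bar> * finite_rank_dist A = \<bar>c\<bar> * finite_rank_dist ((1/c) *\<^sub>R (c *\<^sub>R A))" using False by simp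
  also have "\<dots> \<le> \<bar>c\<bar> * (\<bar>1/c\<bar> * finite_rank_dist (c *\<^sub>R A))"
    by (intro mult_left_mono finite_rank_dist_scaleR_le) auto
  also have "\<dots> = finite_rank_dist (c *\<^sub>R A)" using False by (simp add: abs_divide)
  finally show ?thesis using finite_rank_dist_scaleR_le[of c A] by linarith
qed

lemma finite_rank_dist_minus: "finite_rank_dist (- A) = finite_rank_dist A"
  using finite_rank_dist_scaleR[of "-1" A] by simp

lemma finite_rank_dist_compose_right:
  "finite_rank_dist (A o\<^sub>L B) \<le> finite_rank_dist A * norm B"
proof (rule field_le_epsilon)
  fix e :: real assume "e > 0"
  then have "e / (norm B + 1) > 0" by (simp add: add_nonneg_pos)
  then obtain K where K: "finite_rank K" "norm (A - K) < finite_rank_dist A + e / (norm B + 1)"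
    using finite_rank_dist_approx by blast
  have "finite_rank_dist (A o\<^sub>L B) \<le> norm ((A o\<^sub>L B) - (K o\<^sub>L B))"
    by (rule finite_rank_dist_le[OF finite_rank_compose_right[OF K(1)]])
  also have "(A o\<^sub>L B) - (K o\<^sub>L B) = (A - K) o\<^sub>L B"
    by (rule blinfun_eqI) (simp add: blinfun.diff_left)
  also have "norm \<dots> \<le> norm (A - K) * norm B" by (rule norm_blinfun_compose)
  also have "\<dots> \<le> (finite_rank_dist A + e / (norm B + 1)) * norm B"
    using K(2) by (intro mult_right_mono) auto
  also have "\<dots> = finite_rank_dist A * norm B + e * (norm B / (norm B + 1))" by (simp add: algebra_simps)
  also have "e * (norm B / (norm B + 1)) \<le> e * 1"
    using \<open>e > 0\<close> by (intro mult_left_mono) (auto simp: divide_le_eq_1 add_nonneg_pos)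
  finally show "finite_rank_dist (A o\<^sub>L B) \<le> finite_rank_dist A * norm B + e" by simp
qed

lemma compact_operator_if_finite_rank_dist_0:
  fixes S :: "'a::real_normed_vector \<Rightarrow>\<^sub>L 'b::banach"
  assumes "finite_rank_dist S = 0"
  shows "compact_operator S"
proof (rule compact_operator_closure_finite_rank)
  have "{K. finite_rank K} \<noteq> ({} :: ('a \<Rightarrow>\<^sub>L 'b) set)" using finite_rank_0 by blast
  then show "S \<in> closure {K. finite_rank K}"
    using assms unfolding finite_rank_dist_def by (simp add: in_closure_iff_infdist_zero)
qed


section \<open>Strict singularity\<close>

text \<open>
  Strict singularity in quantitative form. It passes from \<open>T - Id\<close> to \<open>T\<^sup>2 - Id\<close> by a mere norm
  estimate, which makes the repeated squaring of \<open>T\<close> possible.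
\<close>
definition bounded_below_only_finite_dim :: "('a::real_normed_vector \<Rightarrow>\<^sub>L 'b::real_normed_vector) \<Rightarrow> bool"
  where "bounded_below_only_finite_dim S \<longleftrightarrow>
    (\<forall>Y c. subspace Y \<and> closed Y \<and> c > 0 \<and> (\<forall>y\<in>Y. c * norm y \<le> norm (S y)) \<longrightarrow>
      (\<exists>B. finite B \<and> span B = Y))"

text \<open>An operator that is bounded below on \<open>Y\<close> has a Lipschitz inverse on the image of \<open>Y\<close>.\<close>
lemma strictly_singular_bounded_below:
  assumes "strictly_singular S"
  shows "bounded_below_only_finite_dim S"
  unfolding bounded_below_only_finite_dim_def
proof (intro allI impI, elim conjE)
  fix Y c assume Y: "subspace Y" "closed Y" and c: "c > 0" and low: "\<forall>y\<in>Y. c * norm y \<le> norm (S y)"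
  have dst: "c * dist x y \<le> dist (S x) (S y)" if "x \<in> Y" "y \<in> Y" for x y
    using bspec[OF low subspace_diff[OF Y(1) that]] by (simp add: dist_norm blinfun.diff_right)
  have inj: "inj_on (blinfun_apply S) Y"
  proof (rule inj_onI)
    fix x y assume "x \<in> Y" "y \<in> Y" "S x = S y"
    then have "c * dist x y \<le> 0" using dst by fastforce
    then show "x = y" using c by (simp add: mult_le_0_iff)
  qed
  have "homeomorphism Y (blinfun_apply S ` Y) (blinfun_apply S) (inv_into Y (blinfun_apply S))"
  proof (rule homeomorphismI)
    show "continuous_on (blinfun_apply S ` Y) (inv_into Y (blinfun_apply S))"
      unfolding continuous_on_iff
    proof (intro ballI allI impI)
      fix u e assume u: "u \<in> blinfun_apply S ` Y" and e: "(e::real) > 0"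
      have "dist (inv_into Y (blinfun_apply S) v) (inv_into Y (blinfun_apply S) u) < e"
        if v: "v \<in> blinfun_apply S ` Y" "dist v u < c * e" for v
      proof -
        have "c * dist (inv_into Y (blinfun_apply S) v) (inv_into Y (blinfun_apply S) u) \<le> dist v u"
          using dst[OF inv_into_into[OF v(1)] inv_into_into[OF u]] by (simp add: f_inv_into_f u v(1))
        also have "\<dots> < c * e" by (rule v(2))
        finally show ?thesis using c by simp
      qed
      then show "\<exists>d>0. \<forall>v\<in>blinfun_apply S ` Y. dist v u < d \<longrightarrow>
          dist (inv_into Y (blinfun_apply S) v) (inv_into Y (blinfun_apply S) u) < e"
        using c e by (intro exI[of _ "c * e"]) simp
    qed
  qed (use inj in \<open>auto intro!: linear_continuous_on blinfun.bounded_linear_right simp: inv_into_into f_inv_into_f inv_into_f_f\<close>)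
  then show "\<exists>B. finite B \<and> span B = Y"
    using assms Y unfolding strictly_singular_def by blast
qed


section \<open>Square roots of operators\<close>

text \<open>
  The iterates approximate \<open>E = Id - (Id - Q)\<^sup>1\<^sup>/\<^sup>2\<close>, the smallest solution of
  \<open>2 E = Q + E\<^sup>2\<close>. All of them are polynomials in \<open>Q\<close> with nonnegative coefficients, so that
  the scalar iteration at \<open>Q = 1\<close> controls everything, including the boundary case
  \<open>\<parallel>Q\<parallel> = 1\<close> that is needed below.
\<close>
primrec sqrt_iter :: "('a::real_normed_vector \<Rightarrow>\<^sub>L 'a) \<Rightarrow> nat \<Rightarrow> ('a \<Rightarrow>\<^sub>L 'a)" where
  "sqrt_iter Q 0 = 0"
| "sqrt_iter Q (Suc k) = (1/2) *\<^sub>R (Q + (sqrt_iter Q k o\<^sub>L sqrt_iter Q k))"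

primrec scalar_iter :: "nat \<Rightarrow> real" where
  "scalar_iter 0 = 0"
| "scalar_iter (Suc k) = (1 + (scalar_iter k)\<^sup>2) / 2"

lemma scalar_iter_bounds: "0 \<le> scalar_iter k \<and> scalar_iter k \<le> 1"
  by (induction k) (auto simp: power_le_one)

lemma scalar_iter_mono: "scalar_iter k \<le> scalar_iter (Suc k)"
  by (induction k) (auto simp: scalar_iter_bounds intro!: divide_right_mono power_mono)

lemma sqrt_iter_norm:
  assumes "norm Q \<le> 1"
  shows "norm (sqrt_iter Q k) \<le> scalar_iter k"
proof (induction k)
  case (Suc k)
  have "norm (sqrt_iter Q k o\<^sub>L sqrt_iter Q k) \<le> (scalar_iter k)\<^sup>2"
    unfolding power2_eq_square
    by (rule order_trans[OF norm_blinfun_compose]) (intro mult_mono Suc; simp add: scalar_iter_bounds)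
  then have "norm (Q + (sqrt_iter Q k o\<^sub>L sqrt_iter Q k)) \<le> 1 + (scalar_iter k)\<^sup>2"
    using assms norm_triangle_ineq[of Q "sqrt_iter Q k o\<^sub>L sqrt_iter Q k"] by linarith
  then show ?case by simp
qed simp

text \<open>
  The scalar iteration is a majorant: the identity \<open>E\<^sup>2 - F\<^sup>2 = E (E - F) + (E - F) F\<close> turns
  a bound on one step into a bound on the next, with the same recursion on both sides.
\<close>
lemma sqrt_iter_step:
  assumes "norm Q \<le> 1"
  shows "norm (sqrt_iter Q (Suc k) - sqrt_iter Q k) \<le> scalar_iter (Suc k) - scalar_iter k"
proof (induction k)
  case 0
  show ?case using assms by simp
next
  case (Suc k)
  define E F where "E = sqrt_iter Q (Suc k)" and "F = sqrt_iter Q k"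
  define e f where "e = scalar_iter (Suc k)" and "f = scalar_iter k"
  have ef: "norm E \<le> e" "norm F \<le> f" and IH: "norm (E - F) \<le> e - f"
    using Suc sqrt_iter_norm[OF assms] unfolding E_def F_def e_def f_def by (blast+)
  have "f \<ge> 0" "e \<ge> f" unfolding e_def f_def using scalar_iter_bounds scalar_iter_mono by (blast+)
  have "sqrt_iter Q (Suc (Suc k)) - sqrt_iter Q (Suc k) = (1/2) *\<^sub>R ((E o\<^sub>L E) - (F o\<^sub>L F))"
    unfolding E_def F_def sqrt_iter.simps(2)[of Q "Suc k"]
    by (subst sqrt_iter.simps(2)[of Q k]) (simp del: sqrt_iter.simps add: sqrt_iter.simps(2)[of Q k] algebra_simps)
  also have "(E o\<^sub>L E) - (F o\<^sub>L F) = (E o\<^sub>L (E - F)) + ((E - F) o\<^sub>L F)"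
    by (rule blinfun_eqI) (simp add: blinfun.bilinear_simps)
  finally have "norm (sqrt_iter Q (Suc (Suc k)) - sqrt_iter Q (Suc k))
      = norm ((E o\<^sub>L (E - F)) + ((E - F) o\<^sub>L F)) / 2" by simp
  also have "\<dots> \<le> (e * (e - f) + (e - f) * f) / 2"
  proof -
    have "norm (E o\<^sub>L (E - F)) \<le> e * (e - f)"
      by (rule order_trans[OF norm_blinfun_compose]) (intro mult_mono ef IH; use \<open>f \<ge> 0\<close> \<open>e \<ge> f\<close> in simp)
    moreover have "norm ((E - F) o\<^sub>L F) \<le> (e - f) * f"
      by (rule order_trans[OF norm_blinfun_compose]) (intro mult_mono ef IH; use \<open>f \<ge> 0\<close> \<open>e \<ge> f\<close> in simp)
    ultimately show ?thesis
      by (intro divide_right_mono order_trans[OF norm_triangle_ineq] add_mono) simp_all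
  qed
  also have "\<dots> = (1 + e\<^sup>2) / 2 - (1 + f\<^sup>2) / 2"
    by (simp add: power2_eq_square field_simps)
  also have "\<dots> = scalar_iter (Suc (Suc k)) - scalar_iter (Suc k)"
    unfolding e_def f_def by simp
  finally show ?case .
qed

lemma sqrt_iter_commute:
  assumes "C o\<^sub>L Q = Q o\<^sub>L C"
  shows "C o\<^sub>L sqrt_iter Q k = sqrt_iter Q k o\<^sub>L C"
proof (induction k)
  case (Suc k)
  have c: "C (Q x) = Q (C x)" "C (sqrt_iter Q k x) = sqrt_iter Q k (C x)" for x
    using assms Suc by (metis blinfun_apply_blinfun_compose)+
  show ?case by (rule blinfun_eqI) (simp add: blinfun.bilinear_simps c)
qed simp

text \<open>
  The majorant is increasing and bounded by 1, hence Cauchy, and the operator iterates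
  inherit this. With \<open>R = Id - E\<close> the equation for \<open>E\<close> says \<open>R\<^sup>2 = Id - Q\<close>.
\<close>
lemma operator_sqrt:
  fixes Q :: "'a::banach \<Rightarrow>\<^sub>L 'a"
  assumes "norm Q \<le> 1"
  obtains E where "norm E \<le> 1" "2 *\<^sub>R E = Q + (E o\<^sub>L E)"
    "\<And>C. C o\<^sub>L Q = Q o\<^sub>L C \<Longrightarrow> C o\<^sub>L E = E o\<^sub>L C"
proof -
  have mono: "incseq scalar_iter" by (rule incseq_SucI) (rule scalar_iter_mono)
  have gap: "norm (sqrt_iter Q (m + n) - sqrt_iter Q m) \<le> scalar_iter (m + n) - scalar_iter m" for m n
  proof (induction n)
    case (Suc n)
    then show ?case
      using sqrt_iter_step[OF assms, of "m + n"]
        norm_triangle_ineq[of "sqrt_iter Q (Suc (m + n)) - sqrt_iter Q (m + n)" "sqrt_iter Q (m + n) - sqrt_iter Q m"]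
      by (simp del: sqrt_iter.simps scalar_iter.simps)
  qed simp
  obtain L where "scalar_iter \<longlonglongrightarrow> L"
    using incseq_convergent[OF mono, of 1] scalar_iter_bounds by blast
  then have cau: "Cauchy scalar_iter" by (rule LIMSEQ_imp_Cauchy)
  have "Cauchy (sqrt_iter Q)"
  proof (rule metric_CauchyI)
    fix e :: real assume "e > 0"
    then obtain M where M: "\<And>m n. m \<ge> M \<Longrightarrow> n \<ge> M \<Longrightarrow> dist (scalar_iter m) (scalar_iter n) < e"
      using cau unfolding Cauchy_def by blast
    have *: "dist (sqrt_iter Q m) (sqrt_iter Q n) < e" if "M \<le> n" "n \<le> m" for m n
      using gap[of n "m - n"] M[of m n] that by (simp add: dist_norm abs_if split: if_splits)
    show "\<exists>M. \<forall>m\<ge>M. \<forall>n\<ge>M. dist (sqrt_iter Q m) (sqrt_iter Q n) < e"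
      by (intro exI[of _ M] allI impI) (metis * dist_commute nat_le_linear)
  qed
  then obtain E where E: "sqrt_iter Q \<longlonglongrightarrow> E" using Cauchy_convergent convergent_def by blast
  show ?thesis
  proof
    show "norm E \<le> 1"
      by (rule LIMSEQ_le_const2[OF tendsto_norm[OF E]])
         (metis sqrt_iter_norm[OF assms] scalar_iter_bounds order_trans)
    have "(\<lambda>k. sqrt_iter Q (Suc k)) \<longlonglongrightarrow> (1/2) *\<^sub>R (Q + (E o\<^sub>L E))"
      unfolding sqrt_iter.simps by (intro tendsto_intros E)
    then have "E = (1/2) *\<^sub>R (Q + (E o\<^sub>L E))"
      using LIMSEQ_Suc[OF E] LIMSEQ_unique by blast
    then show "2 *\<^sub>R E = Q + (E o\<^sub>L E)"
      by (metis (no_types, lifting) divide_self_if nonzero_divide_eq_eq scaleR_one scaleR_scaleR times_divide_eq_right zero_neq_numeral mult.right_neutral)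
    fix C assume C: "C o\<^sub>L Q = Q o\<^sub>L C"
    have "(\<lambda>k. C o\<^sub>L sqrt_iter Q k) \<longlonglongrightarrow> (C o\<^sub>L E)" by (intro tendsto_intros E)
    moreover have "(\<lambda>k. sqrt_iter Q k o\<^sub>L C) \<longlonglongrightarrow> (E o\<^sub>L C)" by (intro tendsto_intros E)
    ultimately show "C o\<^sub>L E = E o\<^sub>L C"
      unfolding sqrt_iter_commute[OF C] using LIMSEQ_unique by blast
  qed
qed


section \<open>Isometries that differ from the identity by a strictly singular operator\<close>

definition inverse_isometries :: "('a::real_normed_vector \<Rightarrow>\<^sub>L 'a) \<Rightarrow> ('a \<Rightarrow>\<^sub>L 'a) \<Rightarrow> bool"
  where "inverse_isometries T T' \<longleftrightarrow>
    (\<forall>x. T (T' x) = x \<and> T' (T x) = x \<and> norm (T x) = norm x)"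

definition cosine :: "('a::real_normed_vector \<Rightarrow>\<^sub>L 'a) \<Rightarrow> ('a \<Rightarrow>\<^sub>L 'a) \<Rightarrow> ('a \<Rightarrow>\<^sub>L 'a)"
  where "cosine T T' = (1/2) *\<^sub>R (T + T')"

lemma inverse_isometriesD:
  assumes "inverse_isometries T T'"
  shows "T (T' x) = x" "T' (T x) = x" "norm (T x) = norm x" "norm (T' x) = norm x"
  using assms unfolding inverse_isometries_def by auto (metis)

lemma norm_isometry_le_1:
  fixes T :: "'a::real_normed_vector \<Rightarrow>\<^sub>L 'a"
  assumes "\<And>x. norm (T x) = norm x"
  shows "norm T \<le> 1"
  using assms by (intro norm_blinfun_bound) auto

lemma inverse_isometries_square:
  assumes "inverse_isometries T T'"
  shows "inverse_isometries (T o\<^sub>L T) (T' o\<^sub>L T')"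
  using assms unfolding inverse_isometries_def by simp

text \<open>\<open>T\<^sup>2 - Id = (T + Id) (T - Id)\<close> and \<open>\<parallel>T + Id\<parallel> \<le> 2\<close>.\<close>
lemma bounded_below_only_finite_dim_square:
  assumes "inverse_isometries T T'" "bounded_below_only_finite_dim (T - id_blinfun)"
  shows "bounded_below_only_finite_dim ((T o\<^sub>L T) - id_blinfun)"
  unfolding bounded_below_only_finite_dim_def
proof (intro allI impI, elim conjE)
  fix Y c assume Y: "subspace Y" "closed Y" and c: "(c::real) > 0"
    and low: "\<forall>y\<in>Y. c * norm y \<le> norm (((T o\<^sub>L T) - id_blinfun) y)"
  have "c / 2 * norm y \<le> norm ((T - id_blinfun) y)" if "y \<in> Y" for y
  proof -
    have "((T o\<^sub>L T) - id_blinfun) y = T (T y - y) + (T y - y)"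
      by (simp add: blinfun.bilinear_simps)
    then have "norm (((T o\<^sub>L T) - id_blinfun) y) \<le> norm (T (T y - y)) + norm (T y - y)"
      using norm_triangle_ineq by metis
    also have "\<dots> = 2 * norm (T y - y)"
      by (simp add: inverse_isometriesD(3)[OF assms(1)])
    finally show ?thesis using low that by (force simp: blinfun.diff_left)
  qed
  moreover have "c / 2 > 0" using c by simp
  ultimately show "\<exists>B. finite B \<and> span B = Y"
    using assms(2) Y unfolding bounded_below_only_finite_dim_def by blast
qed

lemma norm_cosine:
  assumes "inverse_isometries T T'"
  shows "norm (cosine T T') \<le> 1"
proof -
  have "norm T \<le> 1" "norm T' \<le> 1"
    using inverse_isometriesD[OF assms] by (auto intro: norm_isometry_le_1)
  then have "norm (T + T') \<le> 2" using norm_triangle_ineq[of T T'] by linarith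
  then show ?thesis unfolding cosine_def by simp
qed

lemma double_angle:
  fixes T :: "'a::real_normed_vector \<Rightarrow>\<^sub>L 'a"
  assumes "inverse_isometries T T'"
  shows "cosine (T o\<^sub>L T) (T' o\<^sub>L T') = 2 *\<^sub>R (cosine T T' o\<^sub>L cosine T T') - id_blinfun"
proof (rule blinfun_eqI)
  fix x :: 'a
  have "(1/2) *\<^sub>R x + (1/2) *\<^sub>R x = x" by (simp flip: scaleR_left_distrib)
  then show "cosine (T o\<^sub>L T) (T' o\<^sub>L T') x = (2 *\<^sub>R (cosine T T' o\<^sub>L cosine T T') - id_blinfun) x"
    unfolding cosine_def
    by (simp add: blinfun.bilinear_simps inverse_isometriesD[OF assms] algebra_simps)
qed

text \<open>The identity \<open>Id - C = - T\<inverse> (T - Id)\<^sup>2 / 2\<close>, and \<open>\<parallel>T - Id\<parallel> \<le> 2\<close>.\<close>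
lemma cosine_lower_bound:
  assumes "inverse_isometries T T'"
  shows "norm (y - cosine T T' y) \<le> norm ((T - id_blinfun) y)"
proof -
  note I = inverse_isometriesD[OF assms]
  define z where "z = T y - y"
  have "y - cosine T T' y = (1/2) *\<^sub>R (2 *\<^sub>R y - (T y + T' y))"
    unfolding cosine_def by (simp add: blinfun.bilinear_simps scaleR_diff_right)
  also have "2 *\<^sub>R y - (T y + T' y) = - T' (T z - z)"
    unfolding z_def by (simp add: blinfun.bilinear_simps I scaleR_2)
  finally have "norm (y - cosine T T' y) = norm (T z - z) / 2" by (simp add: I)
  also have "\<dots> \<le> norm z" using norm_triangle_ineq4[of "T z" z] by (simp add: I)
  finally show ?thesis unfolding z_def by (simp add: blinfun.diff_left)
qed

text \<open>
  The key step. On the kernel \<open>Y\<close> of \<open>R + C\<close> the operator \<open>T - Id\<close> is bounded below: if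
  \<open>T y\<close> were close to \<open>y\<close>, then so would be \<open>C y\<close>, thus \<open>Q y\<close> and with it \<open>E y\<close> would be
  small, and \<open>(R + C) y\<close> would be close to \<open>2 y\<close> instead of being 0.
\<close>
lemma cosine_decomposition:
  fixes T :: "'a::banach \<Rightarrow>\<^sub>L 'a"
  assumes T: "inverse_isometries T T'" and fd: "bounded_below_only_finite_dim (T - id_blinfun)"
  obtains E F where "norm E \<le> 1" "finite_rank F" "cosine T T' = id_blinfun - E + F"
proof -
  define C where "C = cosine T T'"
  define Q where "Q = id_blinfun - (C o\<^sub>L C)"
  note T2 = inverse_isometries_square[OF T]
  have "norm Q \<le> 1"
  proof -
    have "2 *\<^sub>R Q = id_blinfun - cosine (T o\<^sub>L T) (T' o\<^sub>L T')"
      unfolding double_angle[OF T] Q_def C_def by (simp add: algebra_simps scaleR_2)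
    then have "2 * norm Q = norm (id_blinfun - cosine (T o\<^sub>L T) (T' o\<^sub>L T'))"
      by (metis norm_scaleR abs_numeral)
    also have "\<dots> \<le> 2"
      using norm_triangle_ineq4[of id_blinfun "cosine (T o\<^sub>L T) (T' o\<^sub>L T')"] norm_cosine[OF T2]
        norm_blinfun_id_le[where 'a='a] by linarith
    finally show ?thesis by simp
  qed
  then obtain E where E: "norm E \<le> 1" "2 *\<^sub>R E = Q + (E o\<^sub>L E)"
    and comm: "\<And>A. A o\<^sub>L Q = Q o\<^sub>L A \<Longrightarrow> A o\<^sub>L E = E o\<^sub>L A"
    using operator_sqrt by blast
  have "C o\<^sub>L Q = Q o\<^sub>L C"
    unfolding Q_def by (rule blinfun_eqI) (simp add: blinfun.bilinear_simps)
  then have "C o\<^sub>L E = E o\<^sub>L C" by (rule comm)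
  then have CE: "C (E x) = E (C x)" for x by (metis blinfun_apply_blinfun_compose)
  have EE: "E (E x) = 2 *\<^sub>R E x - x + C (C x)" for x
  proof -
    have "blinfun_apply (2 *\<^sub>R E) x = blinfun_apply (Q + (E o\<^sub>L E)) x" using E(2) by simp
    then show ?thesis unfolding Q_def by (simp add: blinfun.bilinear_simps algebra_simps)
  qed
  define F where "F = C - (id_blinfun - E)"
  define Y where "Y = {y. (C + (id_blinfun - E)) y = 0}"
  \<comment> \<open>\<open>(C + R) (C - R) = C\<^sup>2 - R\<^sup>2 = 0\<close>, because \<open>C\<close> and \<open>R = Id - E\<close> commute.\<close>
  have FY: "F x \<in> Y" for x
    unfolding F_def Y_def by (simp add: blinfun.bilinear_simps CE EE scaleR_2)
  have "subspace Y"
    unfolding Y_def subspace_def by (auto simp: blinfun.add_right blinfun.scaleR_right)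
  moreover have "closed Y"
    unfolding Y_def by (intro closed_Collect_eq continuous_intros)
  moreover have "2/3 * norm y \<le> norm ((T - id_blinfun) y)" if "y \<in> Y" for y
  proof -
    have y: "2 *\<^sub>R y = (y - C y) + E y"
      using that unfolding Y_def by (simp add: blinfun.bilinear_simps scaleR_2 algebra_simps)
    \<comment> \<open>\<open>2 E = Q + E\<^sup>2\<close> and \<open>\<parallel>E\<parallel> \<le> 1\<close> allow one copy of \<open>\<parallel>E y\<parallel>\<close> to be absorbed.\<close>
    have "norm (E y) \<le> norm (Q y)"
    proof -
      have "2 * norm (E y) = norm ((2 *\<^sub>R E) y)" by (simp add: blinfun.scaleR_left)
      also have "(2 *\<^sub>R E) y = Q y + E (E y)" unfolding E(2) by (simp add: blinfun.add_left)
      also have "norm (Q y + E (E y)) \<le> norm (Q y) + norm (E (E y))" by (rule norm_triangle_ineq)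
      also have "norm (E (E y)) \<le> 1 * norm (E y)"
        by (rule order_trans[OF norm_blinfun]) (intro mult_right_mono E(1); simp)
      finally show ?thesis by simp
    qed
    also have "Q y = (y - C y) + C (y - C y)"
      unfolding Q_def by (simp add: blinfun.bilinear_simps)
    also have "norm ((y - C y) + C (y - C y)) \<le> norm (y - C y) + norm (C (y - C y))"
      by (rule norm_triangle_ineq)
    also have "norm (C (y - C y)) \<le> 1 * norm (y - C y)"
      unfolding C_def
      by (rule order_trans[OF norm_blinfun]) (intro mult_right_mono norm_cosine[OF T]; simp)
    finally have "norm (E y) \<le> 2 * norm (y - C y)" by simp
    moreover have "2 * norm y \<le> norm (y - C y) + norm (E y)"
      using norm_triangle_ineq[of "y - C y" "E y"] unfolding y[symmetric] by simp
    ultimately show ?thesis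
      using cosine_lower_bound[OF T, of y] unfolding C_def by linarith
  qed
  ultimately obtain B where "finite B" "span B = Y"
    using fd unfolding bounded_below_only_finite_dim_def
    by (metis zero_less_divide_iff zero_less_numeral)
  then have "finite_rank F"
    unfolding finite_rank_def using FY by blast
  moreover have "cosine T T' = id_blinfun - E + F" unfolding F_def C_def by simp
  ultimately show ?thesis using that E(1) by blast
qed

text \<open>
  Modulo finite rank \<open>Id - C\<^sub>2 = 2 (Id - C) (2 Id - E)\<close>, so that \<open>4 (Id - C)\<close> is
  \<open>Id - C\<^sub>2\<close> plus \<open>2 (Id - C) E\<close>. As \<open>\<parallel>E\<parallel> \<le> 1\<close>, the last term costs at most twice the
  distance of \<open>Id - C\<close>, which is subtracted from the four copies on the left.
\<close>
lemma finite_rank_dist_cosine_halves: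
  fixes T :: "'a::banach \<Rightarrow>\<^sub>L 'a"
  assumes T: "inverse_isometries T T'" and fd: "bounded_below_only_finite_dim (T - id_blinfun)"
  shows "finite_rank_dist (id_blinfun - cosine T T')
    \<le> finite_rank_dist (id_blinfun - cosine (T o\<^sub>L T) (T' o\<^sub>L T')) / 2"
proof -
  obtain E F where E: "norm E \<le> 1" and F: "finite_rank F" and C: "cosine T T' = id_blinfun - E + F"
    using cosine_decomposition[OF T fd] by blast
  define A where "A = id_blinfun - cosine T T'"
  define A2 where "A2 = id_blinfun - cosine (T o\<^sub>L T) (T' o\<^sub>L T')"
  have "A2 = 2 *\<^sub>R (A o\<^sub>L (id_blinfun + cosine T T'))"
    unfolding A_def A2_def double_angle[OF T]
    by (rule blinfun_eqI) (simp add: blinfun.bilinear_simps algebra_simps scaleR_2)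
  also have "\<dots> = 4 *\<^sub>R A - 2 *\<^sub>R (A o\<^sub>L E) + 2 *\<^sub>R (A o\<^sub>L F)"
  proof (rule blinfun_eqI)
    fix x
    have "(4::real) *\<^sub>R A x = 2 *\<^sub>R (A x + A x)" by (simp add: scaleR_2[symmetric])
    then show "(2 *\<^sub>R (A o\<^sub>L (id_blinfun + cosine T T'))) x =
        (4 *\<^sub>R A - 2 *\<^sub>R (A o\<^sub>L E) + 2 *\<^sub>R (A o\<^sub>L F)) x"
      unfolding C by (simp add: blinfun.bilinear_simps algebra_simps)
  qed
  finally have "4 *\<^sub>R A = A2 + (2 *\<^sub>R (A o\<^sub>L E) + (-2) *\<^sub>R (A o\<^sub>L F))" by simp
  then have "4 * finite_rank_dist A = finite_rank_dist (A2 + (2 *\<^sub>R (A o\<^sub>L E) + (-2) *\<^sub>R (A o\<^sub>L F)))"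
    by (metis finite_rank_dist_scaleR abs_numeral)
  also have "\<dots> \<le> finite_rank_dist A2 + (2 * finite_rank_dist (A o\<^sub>L E) + 2 * finite_rank_dist (A o\<^sub>L F))"
    using finite_rank_dist_add[of A2 "2 *\<^sub>R (A o\<^sub>L E) + (-2) *\<^sub>R (A o\<^sub>L F)"]
      finite_rank_dist_add[of "2 *\<^sub>R (A o\<^sub>L E)" "(-2) *\<^sub>R (A o\<^sub>L F)"]
    unfolding finite_rank_dist_scaleR by simp
  also have "finite_rank_dist (A o\<^sub>L F) = 0"
    by (rule finite_rank_dist_finite_rank[OF finite_rank_compose_left[OF F]])
  also have "finite_rank_dist (A o\<^sub>L E) \<le> finite_rank_dist A * 1"
    by (rule order_trans[OF finite_rank_dist_compose_right])
       (intro mult_left_mono E finite_rank_dist_nonneg)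
  finally show ?thesis unfolding A_def A2_def by simp
qed

text \<open>
  Repeated squaring: all the powers \<open>T\<^sup>2, T\<^sup>4, T\<^sup>8, \<dots>\<close> satisfy the hypotheses on \<open>T\<close>, so the
  halving can be iterated against one fixed upper bound.
\<close>
lemma halving_imp_zero:
  fixes d :: "('a::banach \<Rightarrow>\<^sub>L 'a) \<Rightarrow> ('a \<Rightarrow>\<^sub>L 'a) \<Rightarrow> real"
  assumes nonneg: "\<And>T T'. 0 \<le> d T T'"
    and bound: "\<And>T T'. inverse_isometries T T' \<Longrightarrow> d T T' \<le> 2"
    and half: "\<And>T T'. inverse_isometries T T' \<Longrightarrow> bounded_below_only_finite_dim (T - id_blinfun)
        \<Longrightarrow> d T T' \<le> d (T o\<^sub>L T) (T' o\<^sub>L T') / 2"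
    and T: "inverse_isometries T T'" and fd: "bounded_below_only_finite_dim (T - id_blinfun)"
  shows "d T T' = 0"
proof -
  have "d T T' \<le> 2 * (1/2) ^ m" for m
    using T fd
  proof (induction m arbitrary: T T')
    case (Suc m)
    have "d (T o\<^sub>L T) (T' o\<^sub>L T') \<le> 2 * (1/2) ^ m"
      using Suc.prems by (intro Suc.IH inverse_isometries_square bounded_below_only_finite_dim_square)
    then show ?case using half[OF Suc.prems] by simp
  qed (use bound in simp)
  moreover have "(\<lambda>m. 2 * (1/2::real) ^ m) \<longlonglongrightarrow> 2 * 0"
    by (intro tendsto_intros LIMSEQ_power_zero) simp
  ultimately have "d T T' \<le> 2 * 0" by (intro LIMSEQ_le_const) blast+
  then show ?thesis using nonneg[of T T'] by simp
qed

lemma norm_id_minus_le_2: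
  fixes A :: "'a::real_normed_vector \<Rightarrow>\<^sub>L 'a"
  assumes "norm A \<le> 1"
  shows "norm (id_blinfun - A) \<le> 2"
  using norm_triangle_ineq4[of id_blinfun A] norm_blinfun_id_le[where 'a='a] assms by linarith

lemma finite_rank_dist_cosine:
  fixes T :: "'a::banach \<Rightarrow>\<^sub>L 'a"
  assumes "inverse_isometries T T'" "bounded_below_only_finite_dim (T - id_blinfun)"
  shows "finite_rank_dist (id_blinfun - cosine T T') = 0"
proof (rule halving_imp_zero[where d = "\<lambda>T T'. finite_rank_dist (id_blinfun - cosine T T')", OF _ _ _ assms])
  show "finite_rank_dist (id_blinfun - cosine U U') \<le> 2" if "inverse_isometries U U'" for U U' :: "'a \<Rightarrow>\<^sub>L 'a"
    using finite_rank_dist_le_norm norm_id_minus_le_2[OF norm_cosine[OF that]] by (rule order_trans)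
qed (rule finite_rank_dist_nonneg finite_rank_dist_cosine_halves; assumption?)+

text \<open>
  From \<open>(Id - T)\<^sup>2 = - 2 (Id - C) T\<close> and \<open>Id - T\<^sup>2 = 2 (Id - T) - (Id - T)\<^sup>2\<close>: since
  \<open>Id - C\<close> has distance 0, the distance of \<open>Id - T\<close> is at most half that of \<open>Id - T\<^sup>2\<close>.
\<close>
lemma finite_rank_dist_isometry:
  fixes T :: "'a::banach \<Rightarrow>\<^sub>L 'a"
  assumes "inverse_isometries T T'" "bounded_below_only_finite_dim (T - id_blinfun)"
  shows "finite_rank_dist (id_blinfun - T) = 0"
proof (rule halving_imp_zero[where d = "\<lambda>T T'. finite_rank_dist (id_blinfun - T)", OF _ _ _ assms])
  show "finite_rank_dist (id_blinfun - U) \<le> 2" if "inverse_isometries U U'" for U U' :: "'a \<Rightarrow>\<^sub>L 'a"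
    using finite_rank_dist_le_norm norm_id_minus_le_2[OF norm_isometry_le_1[OF inverse_isometriesD(3)[OF that]]]
    by (rule order_trans)
next
  fix U U' :: "'a \<Rightarrow>\<^sub>L 'a"
  assume U: "inverse_isometries U U'" and fd: "bounded_below_only_finite_dim (U - id_blinfun)"
  note I = inverse_isometriesD[OF U]
  let ?A = "id_blinfun - cosine U U'"
  have "2 *\<^sub>R (id_blinfun - U) = (id_blinfun - (U o\<^sub>L U)) + (-2) *\<^sub>R (?A o\<^sub>L U)"
    unfolding cosine_def
    by (rule blinfun_eqI) (simp add: blinfun.bilinear_simps I scaleR_diff_right scaleR_2 flip: scaleR_left_distrib)
  then have "2 * finite_rank_dist (id_blinfun - U)
      = finite_rank_dist ((id_blinfun - (U o\<^sub>L U)) + (-2) *\<^sub>R (?A o\<^sub>L U))"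
    by (metis finite_rank_dist_scaleR abs_numeral)
  also have "\<dots> \<le> finite_rank_dist (id_blinfun - (U o\<^sub>L U)) + 2 * finite_rank_dist (?A o\<^sub>L U)"
    using finite_rank_dist_add[of "id_blinfun - (U o\<^sub>L U)" "(-2) *\<^sub>R (?A o\<^sub>L U)"]
    unfolding finite_rank_dist_scaleR by simp
  also have "finite_rank_dist (?A o\<^sub>L U) \<le> 0"
    using finite_rank_dist_compose_right[of ?A U] finite_rank_dist_cosine[OF U fd] by simp
  finally show "finite_rank_dist (id_blinfun - U) \<le> finite_rank_dist (id_blinfun - (U o\<^sub>L U)) / 2" by simp
qed (rule finite_rank_dist_nonneg)

lemma finite_rank_dist_surjective_isometry:
  fixes T :: "'a::banach \<Rightarrow>\<^sub>L 'a"
  assumes "surjective_isometry T" "bounded_below_only_finite_dim (T - id_blinfun)"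
  shows "finite_rank_dist (T - id_blinfun) = 0"
proof -
  have iso: "norm (T x) = norm x" and sur: "surj (blinfun_apply T)" for x
    using assms(1) unfolding surjective_isometry_def by auto
  have inj: "inj (blinfun_apply T)"
  proof (rule injI)
    fix x y assume "T x = T y"
    then have "norm (T (x - y)) = 0" by (simp add: blinfun.diff_right)
    then show "x = y" by (simp add: iso)
  qed
  define g where "g = inv (blinfun_apply T)"
  have Tg: "T (g x) = x" and gT: "g (T x) = x" for x
    unfolding g_def using sur inj by (simp_all add: surj_f_inv_f)
  have "bounded_linear g"
  proof (rule bounded_linear_intro[where K = 1])
    show "g (x + y) = g x + g y" for x y
      using gT[of "g x + g y"] by (simp add: blinfun.add_right Tg)
    show "g (r *\<^sub>R x) = r *\<^sub>R g x" for r x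
      using gT[of "r *\<^sub>R g x"] by (simp add: blinfun.scaleR_right Tg)
    show "norm (g x) \<le> norm x * 1" for x
      using iso[of "g x"] by (simp add: Tg)
  qed
  then have "inverse_isometries T (Blinfun g)"
    unfolding inverse_isometries_def by (simp add: bounded_linear_Blinfun_apply Tg gT iso)
  then have "finite_rank_dist (id_blinfun - T) = 0" using assms(2) by (rule finite_rank_dist_isometry)
  then show ?thesis using finite_rank_dist_minus[of "id_blinfun - T"] by simp
qed

theorem proposition34:
  fixes T :: "'a::banach \<Rightarrow>\<^sub>L 'a"
  assumes "lambda_Id_plus_S_property TYPE('a)"
    and "surjective_isometry T"
  shows "\<exists>K :: 'a \<Rightarrow>\<^sub>L 'a. compact_operator K \<and> (T = id_blinfun + K \<or> T = - id_blinfun + K)"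
proof (cases "\<exists>B. finite B \<and> span B = (UNIV :: 'a set)")
  case True
  then have "finite_rank (T - id_blinfun)" unfolding finite_rank_def by blast
  then have "compact_operator (T - id_blinfun)"
    by (intro compact_operator_if_finite_rank_dist_0 finite_rank_dist_finite_rank)
  then show ?thesis by (intro exI[of _ "T - id_blinfun"]) simp
next
  case False
  have iso: "norm (T x) = norm x" for x
    using assms(2) unfolding surjective_isometry_def by blast
  obtain c S where S: "strictly_singular S" and T: "T = c *\<^sub>R id_blinfun + S"
    using assms(1) unfolding lambda_Id_plus_S_property_def by blast
  have fd: "bounded_below_only_finite_dim S" using S by (rule strictly_singular_bounded_below)
  have "\<bar>c\<bar> = 1"
  proof (rule ccontr)
    assume "\<bar>c\<bar> \<noteq> 1"
    then have "\<bar>1 - \<bar>c\<bar>\<bar> > 0" by simp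
    moreover have "\<bar>1 - \<bar>c\<bar>\<bar> * norm x \<le> norm (S x)" for x
    proof -
      have "\<bar>1 - \<bar>c\<bar>\<bar> * norm x = \<bar>(1 - \<bar>c\<bar>) * norm x\<bar>" by (simp add: abs_mult)
      also have "\<dots> = \<bar>norm (T x) - norm (c *\<^sub>R x)\<bar>" by (simp add: iso algebra_simps)
      also have "\<dots> \<le> norm (T x - c *\<^sub>R x)" by (rule norm_triangle_ineq3)
      also have "T x - c *\<^sub>R x = S x" unfolding T by (simp add: blinfun.bilinear_simps)
      finally show ?thesis .
    qed
    ultimately show False
      using fd False subspace_UNIV closed_UNIV unfolding bounded_below_only_finite_dim_def by blast
  qed
  then consider "c = 1" | "c = -1" by linarith
  then show ?thesis
  proof cases
    case 1
    then have "S = T - id_blinfun" by (simp add: T)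
    then have "finite_rank_dist S = 0"
      using finite_rank_dist_surjective_isometry[OF assms(2)] fd by simp
    then show ?thesis using T 1 compact_operator_if_finite_rank_dist_0 by auto
  next
    case 2
    have "surjective_isometry (- T)"
      using assms(2) unfolding surjective_isometry_def surj_def
      by (auto simp: blinfun.minus_left) (metis add.inverse_inverse blinfun.minus_right)
    moreover have "(- T) - id_blinfun = - S" by (simp add: T 2)
    moreover have "bounded_below_only_finite_dim (- S)"
      using fd unfolding bounded_below_only_finite_dim_def by (simp add: blinfun.minus_left)
    ultimately have "finite_rank_dist (- S) = 0"
      using finite_rank_dist_surjective_isometry[of "- T"] by simp
    then show ?thesis
      using T 2 compact_operator_if_finite_rank_dist_0 unfolding finite_rank_dist_minus by auto
  qed
qed

end
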